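(* Let $\mathcal{C}\subset\mathbb{R}^n$ be a nonempty compact convex set and let $f:\mathbb{R}^n\to\mathbb{R}$ be continuously differentiable, with $\nabla f$ Lipschitz continuous on $\mathcal{C}$ with constant $L>0$. Assume that $f$ is star-convex in $\mathcal{C}$, and let $f^*:=\min_{x\in\mathcal{C}}f(x)$. Let $L_0>0$, and let $\{x^k\}_{k\in\mathbb{N}}$ be an infinite sequence generated by the Frank--Wolfe algorithm, with $\omega(x^k)<0$ for all $k$, using either the Lipschitz-based adaptive stepsize (with initial estimate $L_0$) or the diminishing stepsize. Then: (i) $\displaystyle f(x^k)-f^*\le\frac{4(L+L_0)\operatorname{diam}(\mathcal{C})^2}{k}$ for all $k=1,2,\dots$; (ii) $\displaystyle \min_{\ell\in\{\lfloor k/2\rfloor+2,\dots,k\}}|\omega(x^\ell)|\le\frac{16(L+L_0)\operatorname{diam}(\mathcal{C})^2}{k-2}$ for all $k=3,4,\dots$.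
   Context: Norms are Euclidean; $\operatorname{diam}(\mathcal{C}):=\max\{\|x-y\|: x,y\in\mathcal{C}\}$; $\lfloor k/2\rfloor$ is the largest integer $\le k/2$. Star-convexity: $f$ is star-convex in the convex set $\mathcal{C}$ if the set $X^*$ of global minimizers of $f$ on $\mathcal{C}$ is nonempty and for every $x^*\in X^*$, every $x\in\mathcal{C}$ and every $\lambda\in[0,1]$, $f(\lambda x^*+(1-\lambda)x)\le\lambda f(x^* )+(1-\lambda)f(x)$. Frank--Wolfe algorithm: for $x\in\mathcal{C}$ let $p(x)$ be any (chosen) element of $\operatorname{argmin}_{u\in\mathcal{C}}\nabla f(x)^{T}(u-x)$ and $\omega(x):=\nabla f(x)^{T}(p(x)-x)$. One has $\omega(x)\le 0$. Starting from any $x^0\in\mathcal{C}$, the algorithm stops if $\omega(x^k)=0$; otherwise it sets $x^{k+1}:=x^k+\lambda_k(p(x^k)-x^k)$ with a stepsize $\lambda_k\in(0,1]$. Lipschitz-based adaptive stepsize: given $L_0>0$, at iteration $k$ with current estimate $L_k>0$, for $j=0,1,2,\dots$ put $$\lambda_{(j)}:=\min\Big\{1,\frac{|\omega(x^k)|}{2^{j}L_k\|p(x^k)-x^k\|^2}\Big\},$$ and let $j_k$ be the first $j$ for which $$f\big(x^k+\lambda_{(j)}(p(x^k)-x^k)\big)\le f(x^k)-|\omega(x^k)|\lambda_{(j)}+\frac{2^{j}L_k}{2}\|p(x^k)-x^k\|^2\lambda_{(j)}^2.$$ Then set $\lambda_k:=\lambda_{(j_k)}$ and $L_{k+1}:=2^{j_k-1}L_k$.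 (Such a $j_k$ always exists.) Diminishing stepsize: $\lambda_k:=\dfrac{2}{k+2}$ for $k=0,1,\dots$ (in this case $L_0$ is an arbitrary positive number). *)

theory Defs
  imports "HOL-Analysis.Analysis"
begin

definition minimizers :: "'a set \<Rightarrow> ('a \<Rightarrow> real) \<Rightarrow> 'a set"
  where "minimizers C f = {x. is_arg_min f (\<lambda>u. u \<in> C) x}"

definition star_convex_on :: "'a::real_vector set \<Rightarrow> ('a \<Rightarrow> real) \<Rightarrow> bool"
  where "star_convex_on C f \<longleftrightarrow>
    minimizers C f \<noteq> {} \<and>
    (\<forall>xs\<in>minimizers C f. \<forall>x\<in>C. \<forall>t\<in>{0..1}.
      f (t *\<^sub>R xs + (1 - t) *\<^sub>R x) \<le> t * f xs + (1 - t) * f x)"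

text \<open>
  In the following, \<open>g\<close> stands for the gradient of the objective function \<open>f\<close>, and \<open>p\<close> is a
  selection of solutions of the linear subproblems.
\<close>

definition linear_oracle ::
    "'a::real_inner set \<Rightarrow> ('a \<Rightarrow> 'a) \<Rightarrow> ('a \<Rightarrow> 'a) \<Rightarrow> bool"
  where "linear_oracle C g p \<longleftrightarrow> (\<forall>x\<in>C. p x \<in> minimizers C (\<lambda>u. g x \<bullet> (u - x)))"

definition omega :: "('a::real_inner \<Rightarrow> 'a) \<Rightarrow> ('a \<Rightarrow> 'a) \<Rightarrow> 'a \<Rightarrow> real"
  where "omega g p x = g x \<bullet> (p x - x)"

text \<open>An infinite run: the stopping test \<open>omega g p (x k) = 0\<close> never succeeds.\<close>

definition frank_wolfe_run ::
    "'a::real_inner set \<Rightarrow> ('a \<Rightarrow> 'a) \<Rightarrow> ('a \<Rightarrow> 'a) \<Rightarrow> (nat \<Rightarrow> real) \<Rightarrow> (nat \<Rightarrow> 'a) \<Rightarrow> bool"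
  where "frank_wolfe_run C g p lam x \<longleftrightarrow>
    linear_oracle C g p \<and>
    x 0 \<in> C \<and>
    (\<forall>k. omega g p (x k) \<noteq> 0 \<and>
         lam k \<in> {0<..1} \<and>
         x (Suc k) = x k + lam k *\<^sub>R (p (x k) - x k))"

definition trial_step ::
    "('a::real_inner \<Rightarrow> 'a) \<Rightarrow> ('a \<Rightarrow> 'a) \<Rightarrow> real \<Rightarrow> 'a \<Rightarrow> nat \<Rightarrow> real"
  where "trial_step g p Lk x j =
    min 1 (\<bar>omega g p x\<bar> / (2 ^ j * Lk * (norm (p x - x))\<^sup>2))"

definition sufficient_decrease ::
    "('a::real_inner \<Rightarrow> real) \<Rightarrow> ('a \<Rightarrow> 'a) \<Rightarrow> ('a \<Rightarrow> 'a) \<Rightarrow> real \<Rightarrow> 'a \<Rightarrow> nat \<Rightarrow> bool"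
  where "sufficient_decrease f g p Lk x j \<longleftrightarrow>
    (let s = trial_step g p Lk x j
     in f (x + s *\<^sub>R (p x - x))
        \<le> f x - \<bar>omega g p x\<bar> * s + 2 ^ j * Lk / 2 * (norm (p x - x))\<^sup>2 * s\<^sup>2)"

text \<open>
  The exponent \<open>j - 1\<close> in the update of the estimate is \<open>- 1\<close> when the first trial succeeds,
  hence the integer power.
\<close>

definition adaptive_stepsize ::
    "('a::real_inner \<Rightarrow> real) \<Rightarrow> ('a \<Rightarrow> 'a) \<Rightarrow> ('a \<Rightarrow> 'a) \<Rightarrow> real \<Rightarrow> (nat \<Rightarrow> real) \<Rightarrow> (nat \<Rightarrow> 'a) \<Rightarrow> bool"
  where "adaptive_stepsize f g p L0 lam x \<longleftrightarrow>
    (\<exists>Ls. Ls 0 = L0 \<and>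
      (\<forall>k. let j = (LEAST j. sufficient_decrease f g p (Ls k) (x k) j)
           in lam k = trial_step g p (Ls k) (x k) j \<and>
              Ls (Suc k) = 2 powi (int j - 1) * Ls k))"

definition diminishing_stepsize :: "(nat \<Rightarrow> real) \<Rightarrow> bool"
  where "diminishing_stepsize lam \<longleftrightarrow> (\<forall>k. lam k = 2 / (real k + 2))"

end

theory Submission
  imports Defs
begin

text \<open>
  Write \<open>h k = f (x k) - fstar\<close>, \<open>w k = \<bar>omega g p (x k)\<bar>\<close> and \<open>A = (L + L0) * (diameter C)\<^sup>2\<close>.
  Both stepsize rules lead to the same scalar recursion
  \<open>h (k + 1) \<le> h k - t * w k + A * t\<^sup>2\<close> with \<open>t = 2 / (k + 2)\<close>
  (\<open>frank_wolfe_run_decrease\<close>), even though the adaptive rule need not take the step \<open>t\<close>. Indeed its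
  accepted step minimizes over \<open>[0, 1]\<close> the quadratic model with curvature \<open>M = 2 ^ j * L_k\<close>, so the
  value it reaches is at most the value of that model at \<open>t\<close>. Moreover \<open>M \<le> 2 * (L + L0)\<close>: by the
  descent lemma for Lipschitz gradients a trial can fail only with a curvature below \<open>L\<close>, and the
  next estimate is half of the accepted curvature, so the estimates never exceed \<open>max L L0\<close>. For
  the diminishing rule the descent lemma gives the recursion directly.

  Star-convexity enters only through \<open>h k \<le> w k\<close>: differentiating the star-convexity inequality
  at \<open>x k\<close> in the direction of a minimizer bounds the directional derivative there by \<open>- h k\<close>, and the
  linear subproblem does at least as well as the minimizer.

  Everything else is about real sequences. Substituting \<open>w k \<ge> h k\<close> in the recursion gives
  \<open>h k \<le> 4 * A / (k + 2)\<close> for \<open>k \<ge> 1\<close> by induction. For the second claim, \<open>A * t\<^sup>2\<close> is dominated by a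
  telescoping difference, so that the sum of \<open>t * w\<close> over the window from \<open>k div 2 + 2\<close> to \<open>k\<close> is at
  most \<open>16 * A / (k + 2)\<close>; that window has at least \<open>(k - 2) / 2\<close> indices, each with a weight of at
  least \<open>2 / (k + 2)\<close>, which bounds the smallest \<open>w\<close> in it by \<open>16 * A / (k - 2)\<close>.
\<close>

section \<open>Scalar recursions\<close>

text \<open>
  The parabola has its vertex at \<open>a / b\<close>. If the vertex lies to the right of \<open>1\<close>, the parabola decreases
  on \<open>[0, 1]\<close>; otherwise completing the square shows that the vertex is the global minimum.
\<close>
lemma min_step_minimizes_quadratic:
  fixes a b t :: real
  assumes "b > 0" and t: "0 \<le> t" "t \<le> 1"
  defines "s \<equiv> min 1 (a / b)"
  shows "- a * s + b / 2 * s\<^sup>2 \<le> - a * t + b / 2 * t\<^sup>2"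
proof (cases "a \<ge> b")
  case True
  then have s: "s = 1"
    using \<open>b > 0\<close> by (simp add: s_def)
  have "b * (1 + t) \<le> a * 2"
    using True \<open>b > 0\<close> t by (intro mult_mono) auto
  then have "0 \<le> (1 - t) * (a - b / 2 * (1 + t))"
    using t by simp
  then show ?thesis
    unfolding s by (simp add: field_simps power2_eq_square)
next
  case False
  then have s: "s = a / b"
    using \<open>b > 0\<close> by (simp add: s_def)
  have "- a * t + b / 2 * t\<^sup>2 - (- a * s + b / 2 * s\<^sup>2) = b / 2 * (t - s)\<^sup>2"
    unfolding s using \<open>b > 0\<close> by (simp add: field_simps power2_eq_square)
  moreover have "0 \<le> b / 2 * (t - s)\<^sup>2"
    using \<open>b > 0\<close> by simp
  ultimately show ?thesis
    by linarith
qed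

text \<open>
  The recursion shared by both stepsize rules: \<open>h\<close> is the optimality gap of an iterate, \<open>w\<close> its
  Frank-Wolfe gap and \<open>A\<close> the curvature constant.
\<close>
locale gap_recursion =
  fixes h w :: "nat \<Rightarrow> real" and A :: real
  assumes h_nonneg: "h k \<ge> 0"
    and h_le_w: "h k \<le> w k"
    and decrease: "h (Suc k) \<le> h k - w k * (2 / (real k + 2)) + A * (2 / (real k + 2))\<^sup>2"
begin

lemma A_nonneg: "A \<ge> 0"
  using decrease[of 0] h_nonneg[of 1] h_le_w[of 0] by simp

lemma contraction:
  "h (Suc k) \<le> (1 - 2 / (real k + 2)) * h k + A * (2 / (real k + 2))\<^sup>2"
proof -
  have "h k * (2 / (real k + 2)) \<le> w k * (2 / (real k + 2))"
    using h_le_w by (intro mult_right_mono) auto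
  then show ?thesis
    using decrease[of k] by (simp add: algebra_simps)
qed

text \<open>
  At \<open>k = 0\<close> the recursion has \<open>2 / (k + 2) = 1\<close>, which erases \<open>h 0\<close>; this is why the bound does not
  depend on the starting point. The induction step reduces to \<open>(r - 1) * (r + 1) \<le> r\<^sup>2\<close>.
\<close>
lemma sublinear_rate: "h (Suc k) \<le> 4 * A / (real k + 3)"
proof (induction k)
  case 0
  have "h (Suc 0) \<le> A"
    using contraction[of 0] by simp
  then show ?case
    using A_nonneg by simp
next
  case (Suc k)
  define r where "r = real k + 3"
  have r: "r \<ge> 3" "2 / (real (Suc k) + 2) = 2 / r" "real (Suc k) + 3 = r + 1"
    by (simp_all add: r_def)
  have "h (Suc (Suc k)) \<le> (1 - 2 / r) * h (Suc k) + A * (2 / r)\<^sup>2"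
    using contraction[of "Suc k"] unfolding r(2) .
  also have "\<dots> \<le> (1 - 2 / r) * (4 * A / r) + A * (2 / r)\<^sup>2"
    using Suc.IH r(1) by (intro add_right_mono mult_left_mono) (auto simp: r_def)
  also have "\<dots> = 4 * A * ((r - 1) / r\<^sup>2)"
    using r(1) by (simp add: field_simps power2_eq_square)
  also have "\<dots> \<le> 4 * A * (1 / (r + 1))"
    using r(1) A_nonneg by (intro mult_left_mono) (auto simp: field_simps power2_eq_square)
  finally show ?case
    unfolding r(3) by simp
qed

text \<open>
  The error term is absorbed into a potential, because
  \<open>1 / (k + 2)\<^sup>2 \<le> 1 / ((k + 1) * (k + 2)) = 1 / (k + 1) - 1 / (k + 2)\<close>.
\<close>
lemma telescoped_decrease:
  "w k * (2 / (real k + 2)) \<le> (h k + 4 * A / (real k + 1)) - (h (Suc k) + 4 * A / (real (Suc k) + 1))"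
proof -
  have "(2 / (real k + 2))\<^sup>2 \<le> 4 * (1 / (real k + 1) - 1 / (real k + 2))"
  proof -
    have "(2 / (real k + 2))\<^sup>2 = 4 / ((real k + 2) * (real k + 2))"
      by (simp add: power2_eq_square)
    also have "\<dots> \<le> 4 / ((real k + 1) * (real k + 2))"
      by (intro divide_left_mono mult_right_mono) auto
    also have "\<dots> = 4 * (1 / (real k + 1) - 1 / (real k + 2))"
      by (simp add: diff_frac_eq)
    finally show ?thesis .
  qed
  from mult_left_mono[OF this A_nonneg] decrease[of k] show ?thesis
    by (simp add: algebra_simps)
qed

text \<open>
  The window starts near \<open>k / 2\<close> to balance two effects: it must be late enough for the potential at
  its start to be \<open>O(1 / k)\<close>, by the rate for \<open>h\<close>, and long enough for the stepsizes in it to have a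
  sum bounded below. For \<open>k \<ge> 3\<close> it is nonempty.
\<close>
lemma min_gap_rate:
  assumes "k \<ge> 3"
  shows "Min (w ` {k div 2 + 2..k}) \<le> 16 * A / (real k - 2)"
proof -
  define m where "m = k div 2 + 2"
  define W where "W = Min (w ` {m..k})"
  define \<Phi> where "\<Phi> j = h j + 4 * A / (real j + 1)" for j
  have "m \<le> k"
    using assms by (simp add: m_def)
  have W: "0 \<le> W" "W \<le> w j" if "j \<in> {m..k}" for j
  proof -
    have "\<forall>i. 0 \<le> w i"
      using h_nonneg h_le_w order_trans by blast
    then show "0 \<le> W"
      unfolding W_def using \<open>m \<le> k\<close> by (subst Min_ge_iff) auto
    show "W \<le> w j"
      unfolding W_def using that by (intro Min_le) auto
  qed
  have W_nonneg: "0 \<le> W"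
    using W(1)[of m] \<open>m \<le> k\<close> by simp
  \<comment> \<open>The window has \<open>k - k div 2 - 1\<close> elements.\<close>
  have len: "(real k - 2) / 2 \<le> real (card {m..k})"
    unfolding m_def by auto
  have "W * ((real k - 2) / (real k + 2)) = (real k - 2) / 2 * (W * (2 / (real k + 2)))"
    by simp
  also have "\<dots> \<le> real (card {m..k}) * (W * (2 / (real k + 2)))"
    using len W_nonneg by (intro mult_right_mono) auto
  also have "\<dots> = (\<Sum>j\<in>{m..k}. W * (2 / (real k + 2)))"
    by simp
  also have "\<dots> \<le> (\<Sum>j\<in>{m..k}. \<Phi> j - \<Phi> (Suc j))"
  proof (rule sum_mono)
    fix j assume j: "j \<in> {m..k}"
    have "W * (2 / (real k + 2)) \<le> w j * (2 / (real j + 2))"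
      using W[OF j] j by (intro mult_mono divide_left_mono) auto
    also have "\<dots> \<le> \<Phi> j - \<Phi> (Suc j)"
      unfolding \<Phi>_def by (rule telescoped_decrease)
    finally show "W * (2 / (real k + 2)) \<le> \<Phi> j - \<Phi> (Suc j)" .
  qed
  also have "\<dots> = \<Phi> m - \<Phi> (Suc k)"
    using sum_Suc_diff[of m k "\<lambda>j. - \<Phi> j"] \<open>m \<le> k\<close> by simp
  also have "\<dots> \<le> \<Phi> m"
  proof -
    have "0 \<le> \<Phi> (Suc k)"
      unfolding \<Phi>_def using h_nonneg A_nonneg
      by (intro add_nonneg_nonneg divide_nonneg_nonneg) auto
    then show ?thesis
      by simp
  qed
  also have "\<dots> \<le> 4 * A / (real m + 1) + 4 * A / (real m + 1)"
  proof -
    have "4 * A / (real (m - 1) + 3) \<le> 4 * A / (real m + 1)"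
      using A_nonneg by (intro divide_left_mono) (auto simp: m_def)
    moreover have "Suc (m - 1) = m"
      by (simp add: m_def)
    ultimately show ?thesis
      using sublinear_rate[of "m - 1"] by (simp add: \<Phi>_def)
  qed
  also have "\<dots> = 8 * A / (real m + 1)"
    by simp
  \<comment> \<open>\<open>m + 1 = k div 2 + 3\<close> is even at least \<open>(k + 5) / 2\<close>; the weaker bound \<open>(k + 2) / 2\<close> makes
    the factor \<open>k + 2\<close> cancel.\<close>
  also have "\<dots> \<le> 8 * A / ((real k + 2) / 2)"
    using A_nonneg by (intro divide_left_mono) (auto simp: m_def)
  also have "\<dots> = 16 * A / (real k + 2)"
    by simp
  finally have "W * (real k - 2) \<le> 16 * A"
    by (simp add: divide_simps)
  then show ?thesis
    using assms unfolding W_def m_def by (simp add: pos_le_divide_eq)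
qed

end

section \<open>Smoothness and star-convexity\<close>

lemma GDERIV_along_line:
  assumes "\<And>y. GDERIV f y :> g y"
  shows "((\<lambda>t. f (x + t *\<^sub>R d)) has_real_derivative g (x + t *\<^sub>R d) \<bullet> d) (at t)"
proof -
  have "(f has_derivative (\<lambda>v. v \<bullet> g (x + t *\<^sub>R d))) (at (x + t *\<^sub>R d))"
    using assms unfolding gderiv_def by blast
  moreover have "((\<lambda>t. x + t *\<^sub>R d) has_derivative (\<lambda>t. t *\<^sub>R d)) (at t)"
    by (auto intro!: derivative_eq_intros)
  ultimately have "((\<lambda>t. f (x + t *\<^sub>R d)) has_derivative (\<lambda>s. (s *\<^sub>R d) \<bullet> g (x + t *\<^sub>R d))) (at t)"
    by (rule has_derivative_compose[rotated])
  then show ?thesis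
    by (simp add: has_field_derivative_def inner_commute mult.commute[of _ "d \<bullet> _"])
qed

text \<open>
  The descent lemma. Along the segment from \<open>x\<close> to \<open>y\<close>, the difference between \<open>f\<close> and its quadratic model
  has derivative \<open>(g (x + t *\<^sub>R d) - g x) \<bullet> d - L * t * (norm d)\<^sup>2\<close>, which is nonpositive by the
  Cauchy-Schwarz inequality and the Lipschitz condition. Convexity keeps the segment inside \<open>C\<close>,
  where the Lipschitz condition is known.
\<close>
lemma lipschitz_gradient_upper_bound:
  assumes f: "\<And>y. GDERIV f y :> g y" and "convex C" and lip: "L-lipschitz_on C g"
    and "x \<in> C" and "y \<in> C"
  shows "f y \<le> f x + g x \<bullet> (y - x) + L / 2 * (norm (y - x))\<^sup>2"
proof -
  define d where "d = y - x"
  define \<phi> where "\<phi> t = f (x + t *\<^sub>R d) - t * (g x \<bullet> d) - L / 2 * (norm d)\<^sup>2 * t\<^sup>2" for t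
  have "\<phi> 1 \<le> \<phi> 0"
  proof (rule DERIV_nonpos_imp_nonincreasing[where f = \<phi> and a = 0 and b = 1])
    fix t :: real assume t: "0 \<le> t" "t \<le> 1"
    have "x + t *\<^sub>R d = (1 - t) *\<^sub>R x + t *\<^sub>R y"
      by (simp add: d_def algebra_simps)
    then have "x + t *\<^sub>R d \<in> C"
      using convexD_alt[OF \<open>convex C\<close> \<open>x \<in> C\<close> \<open>y \<in> C\<close> t] by simp
    then have "norm (g (x + t *\<^sub>R d) - g x) \<le> L * (t * norm d)"
      using lipschitz_onD[OF lip _ \<open>x \<in> C\<close>] t by (fastforce simp: dist_norm)
    then have "(g (x + t *\<^sub>R d) - g x) \<bullet> d \<le> L * (t * norm d) * norm d"
      by (meson mult_right_mono norm_cauchy_schwarz norm_ge_zero order_trans)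
    then have "g (x + t *\<^sub>R d) \<bullet> d - g x \<bullet> d - L * (norm d)\<^sup>2 * t \<le> 0"
      by (simp add: inner_diff_left power2_eq_square mult_ac)
    moreover have "(\<phi> has_real_derivative g (x + t *\<^sub>R d) \<bullet> d - g x \<bullet> d - L * (norm d)\<^sup>2 * t) (at t)"
      unfolding \<phi>_def by (auto intro!: derivative_eq_intros GDERIV_along_line f)
    ultimately show "\<exists>z. (\<phi> has_real_derivative z) (at t) \<and> z \<le> 0"
      by blast
  qed simp
  then show ?thesis
    by (simp add: \<phi>_def d_def)
qed

text \<open>
  For a star-convex function the first-order inequality of convex functions survives when the second
  point is a minimizer. The function \<open>\<psi>\<close> below compares \<open>f\<close> on the segment towards the minimizer with
  the chord; star-convexity makes \<open>\<psi>\<close> maximal on \<open>[0, 1]\<close> at \<open>0\<close>, so its derivative there cannot be positive.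
\<close>
lemma star_convex_gradient_inequality:
  assumes f: "\<And>y. GDERIV f y :> g y" and "star_convex_on C f"
    and xs: "xs \<in> minimizers C f" and "x \<in> C"
  shows "g x \<bullet> (xs - x) \<le> f xs - f x"
proof (rule ccontr)
  assume "\<not> ?thesis"
  then have pos: "g x \<bullet> (xs - x) - (f xs - f x) > 0"
    by simp
  define \<psi> where "\<psi> t = f (x + t *\<^sub>R (xs - x)) - t * (f xs - f x)" for t
  have "(\<psi> has_real_derivative g x \<bullet> (xs - x) - (f xs - f x)) (at 0)"
    unfolding \<psi>_def
    by (auto intro!: derivative_eq_intros GDERIV_along_line[where t = 0 and g = g, simplified] f)
  from DERIV_pos_inc_right[OF this pos]
  obtain e where e: "e > 0" "\<And>t. 0 < t \<Longrightarrow> t < e \<Longrightarrow> \<psi> 0 < \<psi> t"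
    by auto
  define t where "t = min 1 (e / 2)"
  have t: "0 < t" "t \<le> 1" "t < e"
    using \<open>e > 0\<close> by (auto simp: t_def)
  have "f (t *\<^sub>R xs + (1 - t) *\<^sub>R x) \<le> t * f xs + (1 - t) * f x"
    using assms t unfolding star_convex_on_def by (meson atLeastAtMost_iff less_imp_le)
  moreover have "t *\<^sub>R xs + (1 - t) *\<^sub>R x = x + t *\<^sub>R (xs - x)"
    by (simp add: algebra_simps)
  ultimately have "\<psi> t \<le> \<psi> 0"
    by (simp add: \<psi>_def algebra_simps)
  with e(2)[of t] t show False
    by simp
qed

section \<open>Frank-Wolfe steps\<close>

lemma frank_wolfe_run_in:
  assumes "convex C" and run: "frank_wolfe_run C g p lam x"
  shows "x k \<in> C" and "p (x k) \<in> C"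
proof -
  have p_in: "p y \<in> C" if "y \<in> C" for y
    using run that
    by (auto simp: frank_wolfe_run_def linear_oracle_def minimizers_def is_arg_min_def)
  show "x k \<in> C"
  proof (induction k)
    case 0
    then show ?case
      using run by (simp add: frank_wolfe_run_def)
  next
    case (Suc k)
    have "x (Suc k) = (1 - lam k) *\<^sub>R x k + lam k *\<^sub>R p (x k)" "lam k \<in> {0<..1}"
      using run by (simp_all add: frank_wolfe_run_def algebra_simps)
    then show ?case
      using convexD_alt[OF \<open>convex C\<close> Suc p_in[OF Suc]] by simp
  qed
  then show "p (x k) \<in> C"
    by (rule p_in)
qed

text \<open>
  The minimizer is a feasible point of the linear subproblem, hence the optimal value \<open>omega g p x\<close>
  is at most \<open>g x \<bullet> (xs - x)\<close>. This makes the Frank-Wolfe gap a certificate for the optimality gap.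
\<close>
lemma linear_oracle_gap_lower_bound:
  assumes f: "\<And>y. GDERIV f y :> g y" and star: "star_convex_on C f" and "linear_oracle C g p"
    and xs: "xs \<in> minimizers C f" and "x \<in> C"
  shows "f x - f xs \<le> - omega g p x"
proof -
  have "xs \<in> C"
    using xs by (simp add: minimizers_def is_arg_min_def)
  then have "omega g p x \<le> g x \<bullet> (xs - x)"
    using assms(3) \<open>x \<in> C\<close>
    by (auto simp: omega_def linear_oracle_def minimizers_def is_arg_min_linorder)
  also have "\<dots> \<le> f xs - f x"
    using star_convex_gradient_inequality[OF f star xs \<open>x \<in> C\<close>] .
  finally show ?thesis
    by simp
qed

lemma frank_wolfe_step_decrease:
  assumes f: "\<And>y. GDERIV f y :> g y" and "convex C" and "L-lipschitz_on C g"
    and "x \<in> C" and "p x \<in> C" and s: "0 \<le> s" "s \<le> 1"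
  shows "f (x + s *\<^sub>R (p x - x))
    \<le> f x + omega g p x * s + L / 2 * (norm (p x - x))\<^sup>2 * s\<^sup>2"
proof -
  have "x + s *\<^sub>R (p x - x) = (1 - s) *\<^sub>R x + s *\<^sub>R p x"
    by (simp add: algebra_simps)
  then have "x + s *\<^sub>R (p x - x) \<in> C"
    using convexD_alt[OF \<open>convex C\<close> \<open>x \<in> C\<close> \<open>p x \<in> C\<close> s] by simp
  from lipschitz_gradient_upper_bound[OF f assms(2,3) \<open>x \<in> C\<close> this]
  show ?thesis
    by (simp add: omega_def power_mult_distrib mult_ac)
qed

text \<open>
  Once the trial curvature reaches the Lipschitz constant, the acceptance test is implied by the
  descent lemma. This gives both termination of the line search and the bound on the estimates.
\<close>
lemma sufficient_decrease_of_large_estimate: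
  assumes f: "\<And>y. GDERIV f y :> g y" and "convex C" and "L-lipschitz_on C g"
    and "x \<in> C" and "p x \<in> C" and "omega g p x \<le> 0"
    and large: "L \<le> 2 ^ j * Lk" and "Lk > 0"
  shows "sufficient_decrease f g p Lk x j"
proof -
  define s where "s = trial_step g p Lk x j"
  have "0 \<le> s" "s \<le> 1"
    using \<open>Lk > 0\<close> by (simp_all add: s_def trial_step_def)
  then have "f (x + s *\<^sub>R (p x - x))
    \<le> f x + omega g p x * s + L / 2 * (norm (p x - x))\<^sup>2 * s\<^sup>2"
    using frank_wolfe_step_decrease[where f = f and g = g and p = p, OF assms(1-5)] by simp
  also have "\<dots> \<le> f x + omega g p x * s + 2 ^ j * Lk / 2 * (norm (p x - x))\<^sup>2 * s\<^sup>2"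
    using large by (intro add_left_mono mult_right_mono divide_right_mono) auto
  finally show ?thesis
    using assms(6) by (simp add: sufficient_decrease_def Let_def flip: s_def)
qed

text \<open>
  The trial step minimizes on \<open>[0, 1]\<close> the very model that appears in the acceptance test. So the
  analysis may replace it by any step \<open>t\<close>, in particular by the diminishing one.
\<close>
lemma trial_step_beats_any_step:
  assumes "sufficient_decrease f g p Lk x j" and "Lk > 0" and "p x \<noteq> x"
    and t: "0 \<le> t" "t \<le> 1"
  shows "f (x + trial_step g p Lk x j *\<^sub>R (p x - x))
    \<le> f x - \<bar>omega g p x\<bar> * t + 2 ^ j * Lk / 2 * (norm (p x - x))\<^sup>2 * t\<^sup>2"
proof -
  have "2 ^ j * Lk * (norm (p x - x))\<^sup>2 > 0"
    using assms by simp
  from min_step_minimizes_quadratic[OF this t, of "\<bar>omega g p x\<bar>"] assms(1)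
  show ?thesis
    by (simp add: sufficient_decrease_def trial_step_def Let_def)
qed

text \<open>
  The new estimate is half of the accepted curvature. If the first trial is accepted, the estimate is
  halved; otherwise the previous trial, whose curvature equals the new estimate, was rejected, so the
  new estimate is below \<open>L\<close>. Hence the estimates stay below \<open>L + Ls 0\<close>, and the accepted curvatures
  below twice that.
\<close>
lemma adaptive_estimates:
  fixes Ls :: "nat \<Rightarrow> real"
  assumes f: "\<And>y. GDERIV f y :> g y" and "convex C" and lip: "L-lipschitz_on C g" and "L > 0"
    and x: "\<And>k. x k \<in> C" and p: "\<And>k. p (x k) \<in> C" and om: "\<And>k. omega g p (x k) \<le> 0"
    and "Ls 0 > 0"
    and j: "\<And>k. j k = (LEAST i. sufficient_decrease f g p (Ls k) (x k) i)"
    and upd: "\<And>k. Ls (Suc k) = 2 powi (int (j k) - 1) * Ls k"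
  shows "Ls k > 0"
    and "sufficient_decrease f g p (Ls k) (x k) (j k)"
    and "2 ^ j k * Ls k \<le> 2 * (L + Ls 0)"
proof -
  have pos: "Ls k > 0" for k
    using \<open>Ls 0 > 0\<close> by (induction k) (simp_all add: upd)
  then show "Ls k > 0" .
  note large = sufficient_decrease_of_large_estimate[OF f \<open>convex C\<close> lip x p om _ pos]
  have "\<exists>i. sufficient_decrease f g p (Ls k) (x k) i" for k
  proof -
    obtain i where "L / Ls k < 2 ^ i"
      using real_arch_pow[of 2 "L / Ls k"] by auto
    then have "L \<le> 2 ^ i * Ls k"
      using pos[of k] by (simp add: divide_simps)
    then show ?thesis
      using large by blast
  qed
  then show "sufficient_decrease f g p (Ls k) (x k) (j k)"
    unfolding j by (rule LeastI_ex)
  have double: "2 ^ j k * Ls k = 2 * Ls (Suc k)" for k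
    by (simp add: upd power_int_diff)
  have bound: "Ls k \<le> L + Ls 0" for k
  proof (induction k)
    case 0
    then show ?case
      using \<open>L > 0\<close> by simp
  next
    case (Suc k)
    show ?case
    proof (cases "j k")
      case 0
      then show ?thesis
        using Suc pos[of k] double[of k] by simp
    next
      case (Suc i)
      then have "\<not> sufficient_decrease f g p (Ls k) (x k) i"
        using not_less_Least[of i] unfolding j by (metis lessI)
      then have "2 ^ i * Ls k < L"
        using large by (meson not_less)
      then show ?thesis
        using double[of k] Suc \<open>Ls 0 > 0\<close> by simp
    qed
  qed
  show "2 ^ j k * Ls k \<le> 2 * (L + Ls 0)"
    using bound[of "Suc k"] by (simp add: double)
qed

text \<open>
  Both rules give a decrease with some curvature \<open>M \<le> 2 * (L + L0)\<close>: the accepted one for the adaptive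
  rule, and \<open>L\<close> for the diminishing rule.
\<close>
lemma frank_wolfe_run_decrease:
  assumes f: "\<And>y. GDERIV f y :> g y" and "convex C" and "bounded C"
    and lip: "L-lipschitz_on C g" and "L > 0" and "L0 > 0"
    and run: "frank_wolfe_run C g p lam x"
    and om: "\<And>k. omega g p (x k) < 0"
    and steps: "adaptive_stepsize f g p L0 lam x \<or> diminishing_stepsize lam"
  shows "f (x (Suc k)) \<le> f (x k) - \<bar>omega g p (x k)\<bar> * (2 / (real k + 2))
    + (L + L0) * (diameter C)\<^sup>2 * (2 / (real k + 2))\<^sup>2"
proof -
  note inC = frank_wolfe_run_in[OF \<open>convex C\<close> run]
  define t where "t = 2 / (real k + 2)"
  define d where "d = norm (p (x k) - x k)"
  have t: "0 \<le> t" "t \<le> 1"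
    by (simp_all add: t_def)
  have step: "x (Suc k) = x k + lam k *\<^sub>R (p (x k) - x k)"
    using run by (simp add: frank_wolfe_run_def)
  have d: "d\<^sup>2 \<le> (diameter C)\<^sup>2"
    using diameter_bounded_bound[OF \<open>bounded C\<close> inC(2) inC(1)]
    by (simp add: d_def dist_norm power_mono)
  obtain M where M: "M \<le> 2 * (L + L0)"
    and dec: "f (x (Suc k)) \<le> f (x k) - \<bar>omega g p (x k)\<bar> * t + M / 2 * d\<^sup>2 * t\<^sup>2"
    using steps
  proof
    assume "adaptive_stepsize f g p L0 lam x"
    then obtain Ls where Ls: "Ls 0 = L0"
      and upd: "\<And>k. let j = (LEAST j. sufficient_decrease f g p (Ls k) (x k) j)
        in lam k = trial_step g p (Ls k) (x k) j \<and> Ls (Suc k) = 2 powi (int j - 1) * Ls k"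
      unfolding adaptive_stepsize_def by blast
    define j where "j k = (LEAST j. sufficient_decrease f g p (Ls k) (x k) j)" for k
    have lam: "lam k = trial_step g p (Ls k) (x k) (j k)"
      and Suc: "Ls (Suc k) = 2 powi (int (j k) - 1) * Ls k" for k
      using upd[of k] by (simp_all add: Let_def j_def)
    \<comment> \<open>The quadratic model is then strictly convex, so its minimizer over \<open>[0, 1]\<close> is the trial step.\<close>
    have "p (x k) \<noteq> x k"
      using om[of k] by (auto simp: omega_def)
    note est = adaptive_estimates[where Ls = Ls and j = j and k = k and x = x and p = p,
        OF f \<open>convex C\<close> lip \<open>L > 0\<close> inC less_imp_le[OF om] _ j_def Suc]
    show thesis
    proof (rule that)
      show "2 ^ j k * Ls k \<le> 2 * (L + L0)"
        using est(3) Ls \<open>L0 > 0\<close> by simp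
      show "f (x (Suc k)) \<le> f (x k) - \<bar>omega g p (x k)\<bar> * t + 2 ^ j k * Ls k / 2 * d\<^sup>2 * t\<^sup>2"
        unfolding step lam d_def
        using trial_step_beats_any_step[OF est(2,1) \<open>p (x k) \<noteq> x k\<close> t] Ls \<open>L0 > 0\<close> by simp
    qed
  next
    assume "diminishing_stepsize lam"
    then have "lam k = t"
      by (simp add: diminishing_stepsize_def t_def)
    then show thesis
      using that[of L] frank_wolfe_step_decrease[where p = p, OF f \<open>convex C\<close> lip inC t] om[of k] \<open>L > 0\<close> \<open>L0 > 0\<close>
      by (simp add: step d_def)
  qed
  have "M / 2 * d\<^sup>2 * t\<^sup>2 \<le> (L + L0) * (diameter C)\<^sup>2 * t\<^sup>2"
    using M d \<open>L > 0\<close> \<open>L0 > 0\<close> by (intro mult_right_mono mult_mono) auto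
  with dec show ?thesis
    unfolding t_def by linarith
qed

section \<open>Convergence rates\<close>

theorem theorem5p5:
  fixes C :: "(real ^ 'n) set"
    and f :: "real ^ 'n \<Rightarrow> real"
    and g p :: "real ^ 'n \<Rightarrow> real ^ 'n"
    and L L0 fstar :: real
    and lam :: "nat \<Rightarrow> real"
    and x :: "nat \<Rightarrow> real ^ 'n"
  assumes "C \<noteq> {}" and "compact C" and "convex C"
    and "\<And>y. GDERIV f y :> g y" and "continuous_on UNIV g"
    and "L > 0" and "L-lipschitz_on C g"
    and "star_convex_on C f"
    and "fstar = (LEAST v. v \<in> f ` C)"
    and "L0 > 0"
    and "frank_wolfe_run C g p lam x"
    and "\<And>k. omega g p (x k) < 0"
    and "adaptive_stepsize f g p L0 lam x \<or> diminishing_stepsize lam"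
  shows "(\<forall>k\<ge>1. f (x k) - fstar \<le> 4 * (L + L0) * (diameter C)\<^sup>2 / real k) \<and>
         (\<forall>k\<ge>3. Min ((\<lambda>l. \<bar>omega g p (x l)\<bar>) ` {k div 2 + 2..k})
                  \<le> 16 * (L + L0) * (diameter C)\<^sup>2 / (real k - 2))"
proof -
  obtain xs where xs: "xs \<in> minimizers C f"
    using assms(8) by (auto simp: star_convex_on_def)
  then have "xs \<in> C" and min: "\<And>y. y \<in> C \<Longrightarrow> f xs \<le> f y"
    by (auto simp: minimizers_def is_arg_min_linorder)
  have fstar: "fstar = f xs"
    unfolding assms(9) using \<open>xs \<in> C\<close> min by (intro Least_equality) auto
  note inC = frank_wolfe_run_in[OF assms(3,11)]
  define A where "A = (L + L0) * (diameter C)\<^sup>2"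
  interpret gap_recursion "\<lambda>k. f (x k) - fstar" "\<lambda>k. \<bar>omega g p (x k)\<bar>" A
  proof
    fix k
    show "0 \<le> f (x k) - fstar"
      using min inC(1) by (simp add: fstar)
    have "linear_oracle C g p"
      using assms(11) by (simp add: frank_wolfe_run_def)
    from linear_oracle_gap_lower_bound[OF assms(4,8) this xs inC(1)[of k]]
    show "f (x k) - fstar \<le> \<bar>omega g p (x k)\<bar>"
      by (simp add: fstar)
    show "f (x (Suc k)) - fstar \<le> f (x k) - fstar - \<bar>omega g p (x k)\<bar> * (2 / (real k + 2))
        + A * (2 / (real k + 2))\<^sup>2"
      using frank_wolfe_run_decrease[OF assms(4,3) compact_imp_bounded[OF assms(2)]
          assms(7,6,10,11,12,13), of k]
      by (simp add: A_def)
  qed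
  have "f (x k) - fstar \<le> 4 * A / real k" if "k \<ge> 1" for k
  proof -
    have "f (x k) - fstar \<le> 4 * A / (real (k - 1) + 3)"
      using sublinear_rate[of "k - 1"] that by simp
    also have "\<dots> \<le> 4 * A / real k"
      using that A_nonneg by (intro divide_left_mono) auto
    finally show ?thesis .
  qed
  moreover have "Min ((\<lambda>l. \<bar>omega g p (x l)\<bar>) ` {k div 2 + 2..k}) \<le> 16 * A / (real k - 2)"
    if "k \<ge> 3" for k
    using min_gap_rate[OF that] .
  ultimately show ?thesis
    unfolding A_def mult.assoc[symmetric] by blast
qed

end
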